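(* Let $G$ be a connected graph of order $n\geq 3$. Then $$\Big\lceil \frac{n}{2}\Big\rceil\leq \gamma_1^{\mathrm L}(G)\leq n-\rho(G).$$ Moreover, the upper bound is attained (that is, $\gamma_1^{\mathrm L}(G)=n-\rho(G)$) if and only if there exists a $\rho(G)$-set $P\subseteq V(G)$ such that its complement $V(G)-P$ is a $\gamma_1^{\mathrm L}(G)$-set.
   Context: All graphs are finite, simple and undirected; $N(v)$ is the open and $N[v]=N(v)\cup\{v\}$ the closed neighborhood of $v$. A dominating set of $G$ is a set $D\subseteq V(G)$ such that every vertex not in $D$ has a neighbor in $D$. A $1$-limited dominating set is a dominating set $D$ with $|N(u)-D|\le 1$ for every $u\in D$; $\gamma_1^{\mathrm L}(G)$ is the minimum cardinality of a $1$-limited dominating set, and a $\gamma_1^{\mathrm L}(G)$-set is a $1$-limited dominating set of that cardinality. A set $S\subseteq V(G)$ is a packing if $N[u]\cap N[v]=\emptyset$ for all distinct $u,v\in S$; the packing number $\rho(G)$ is the maximum cardinality of a packing, and a $\rho(G)$-set is a packing of cardinality $\rho(G)$. *)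

theory Defs
  imports Complex_Main "Graph_Theory.Digraph_Component"
begin

text \<open>
  A finite simple undirected graph is a term \<open>G\<close> satisfying the locale predicate \<open>graph\<close>, i.e. a
  finite symmetric digraph without loops or parallel arcs (an edge is a pair of opposite arcs),
  with \<open>u \<rightarrow>\<^bsub>G\<^esub> v\<close> as its adjacency relation. The library's \<open>Digraph_Component.connected\<close> requires a nonempty
  vertex set.
\<close>

definition open_nbhd :: "('a, 'b) pre_digraph \<Rightarrow> 'a \<Rightarrow> 'a set" where
  "open_nbhd G v = {u \<in> verts G. v \<rightarrow>\<^bsub>G\<^esub> u}"

definition closed_nbhd :: "('a, 'b) pre_digraph \<Rightarrow> 'a \<Rightarrow> 'a set" where
  "closed_nbhd G v = insert v (open_nbhd G v)"

definition dominating_set :: "('a, 'b) pre_digraph \<Rightarrow> 'a set \<Rightarrow> bool" where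
  "dominating_set G D \<longleftrightarrow>
     D \<subseteq> verts G \<and> (\<forall>v \<in> verts G - D. open_nbhd G v \<inter> D \<noteq> {})"

definition one_limited_dominating_set :: "('a, 'b) pre_digraph \<Rightarrow> 'a set \<Rightarrow> bool" where
  "one_limited_dominating_set G D \<longleftrightarrow>
     dominating_set G D \<and> (\<forall>u \<in> D. card (open_nbhd G u - D) \<le> 1)"

definition one_limited_domination_number :: "('a, 'b) pre_digraph \<Rightarrow> nat" where
  "one_limited_domination_number G = Min (card ` {D. one_limited_dominating_set G D})"

definition min_one_limited_dominating_set :: "('a, 'b) pre_digraph \<Rightarrow> 'a set \<Rightarrow> bool" where
  "min_one_limited_dominating_set G D \<longleftrightarrow>
     one_limited_dominating_set G D \<and> card D = one_limited_domination_number G"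

definition packing :: "('a, 'b) pre_digraph \<Rightarrow> 'a set \<Rightarrow> bool" where
  "packing G S \<longleftrightarrow> S \<subseteq> verts G \<and>
     (\<forall>u \<in> S. \<forall>v \<in> S. u \<noteq> v \<longrightarrow> closed_nbhd G u \<inter> closed_nbhd G v = {})"

definition packing_number :: "('a, 'b) pre_digraph \<Rightarrow> nat" where
  "packing_number G = Max (card ` {S. packing G S})"

definition max_packing :: "('a, 'b) pre_digraph \<Rightarrow> 'a set \<Rightarrow> bool" where
  "max_packing G S \<longleftrightarrow> packing G S \<and> card S = packing_number G"

text \<open>For a graph, \<open>Min\<close> and \<open>Max\<close> above range over finite nonempty sets.\<close>

lemma one_limited_dominating_set_verts: "one_limited_dominating_set G (verts G)"
proof -
  have "card (open_nbhd G u - verts G) = 0" for u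
    by (rule card_eq_0_iff[THEN iffD2]) (auto simp: open_nbhd_def)
  then show ?thesis
    by (simp add: one_limited_dominating_set_def dominating_set_def)
qed

lemma finite_one_limited_dominating_sets:
  assumes "graph G"
  shows "finite {D. one_limited_dominating_set G D}"
proof -
  interpret graph G by fact
  show ?thesis
    by (rule finite_subset[of _ "Pow (verts G)"])
       (auto simp: one_limited_dominating_set_def dominating_set_def)
qed

lemma packing_empty: "packing G {}"
  by (simp add: packing_def)

lemma finite_packings:
  assumes "graph G"
  shows "finite {S. packing G S}"
proof -
  interpret graph G by fact
  show ?thesis
    by (rule finite_subset[of _ "Pow (verts G)"]) (auto simp: packing_def)
qed

end

theory Submission
  imports Defs
begin

text \<open>
  Lower bound: in a \<open>1\<close>-limited dominating set \<open>D\<close>, sending each vertex outside \<open>D\<close> to a neighbor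
  in \<open>D\<close> is injective, because no vertex of \<open>D\<close> has two neighbors outside \<open>D\<close>. So at least half
  of the vertices lie in \<open>D\<close> (\<open>card_verts_le_twice_one_limited\<close>).

  Upper bound: in a packing \<open>P\<close> no two vertices are adjacent, and no two have a common neighbor.
  The second property says exactly that every vertex outside \<open>P\<close> has at most one neighbor in \<open>P\<close>,
  the first that all neighbors of a vertex of \<open>P\<close> lie outside \<open>P\<close>; hence, when no vertex is
  isolated, \<open>V(G) - P\<close> is \<open>1\<close>-limited dominating (\<open>one_limited_complement_of_packing\<close>).
  A connected graph with more than one vertex has no isolated vertex.

  The characterization of equality compares cardinalities: for any \<open>\<rho>(G)\<close>-set \<open>P\<close>,
  the \<open>1\<close>-limited dominating set \<open>V(G) - P\<close> has exactly \<open>n - \<rho>(G)\<close> vertices.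
\<close>

lemma (in graph) open_nbhd_sym: "v \<in> open_nbhd G u \<longleftrightarrow> u \<in> open_nbhd G v"
  by (auto simp: open_nbhd_def dest: adj_in_verts
      intro: arcs_ends_symmetric[OF sym_arcs])

lemma (in graph) finite_open_nbhd: "finite (open_nbhd G u)"
  by (simp add: open_nbhd_def)

lemma (in graph) open_nbhd_nonempty_if_connected:
  assumes "Digraph_Component.connected G" and "card (verts G) \<ge> 2" and "v \<in> verts G"
  shows "open_nbhd G v \<noteq> {}"
proof -
  have "\<not> verts G \<subseteq> {v}"
    using assms(2) card_mono[of "{v}" "verts G"] by auto
  then obtain w where w: "w \<in> verts G" "w \<noteq> v"
    by blast
  have "strongly_connected G"
    using assms(1) by (rule symmetric_connected_imp_strongly_connected[OF sym_arcs])
  with assms(3) w have "v \<rightarrow>\<^sup>*\<^bsub>G\<^esub> w"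
    by auto
  then have "\<exists>u. v \<rightarrow>\<^bsub>G\<^esub> u"
    using w(2) by (cases rule: converse_reachable_cases) auto
  then show ?thesis
    by (auto simp: open_nbhd_def dest: adj_in_verts)
qed

text \<open>Choosing a dominator for each vertex outside \<open>D\<close> gives an injection into \<open>D\<close>: two vertices
  with the same dominator \<open>u\<close> would both lie in \<open>N(u) - D\<close>, which has at most one element.\<close>

lemma (in graph) card_verts_le_twice_one_limited:
  assumes "one_limited_dominating_set G D"
  shows "card (verts G) \<le> 2 * card D"
proof -
  have D: "D \<subseteq> verts G" and fin: "finite D"
    using assms finite_subset[OF _ finite_verts]
    by (auto simp: one_limited_dominating_set_def dominating_set_def)
  have "\<forall>v \<in> verts G - D. \<exists>u. u \<in> open_nbhd G v \<inter> D"
    using assms unfolding one_limited_dominating_set_def dominating_set_def by blast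
  then obtain f where f: "\<And>v. v \<in> verts G - D \<Longrightarrow> f v \<in> open_nbhd G v \<inter> D"
    by metis
  have "inj_on f (verts G - D)"
  proof (rule inj_onI)
    fix x y assume x: "x \<in> verts G - D" and y: "y \<in> verts G - D" and eq: "f x = f y"
    have "x \<in> open_nbhd G (f x) - D" "y \<in> open_nbhd G (f x) - D"
      using f[OF x] f[OF y] x y eq open_nbhd_sym by auto
    moreover have "card (open_nbhd G (f x) - D) \<le> 1"
      using assms f[OF x] by (auto simp: one_limited_dominating_set_def)
    ultimately show "x = y"
      using card_le_Suc0_iff_eq[of "open_nbhd G (f x) - D"] finite_open_nbhd by auto
  qed
  then have "card (verts G - D) \<le> card D"
    by (rule card_inj_on_le) (use f fin in auto)
  then show ?thesis
    using card_Diff_subset[OF fin D] by simp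
qed

text \<open>An isolated vertex of \<open>P\<close> would be undominated, so such vertices have to be excluded; a
  neighbor \<open>q\<close> of \<open>p \<in> P\<close> lies in \<open>N[p] \<inter> N[q]\<close>, hence outside \<open>P\<close>, and two neighbors of \<open>u\<close> in
  \<open>P\<close> have \<open>u\<close> in both their closed neighborhoods.\<close>

lemma (in graph) one_limited_complement_of_packing:
  assumes "packing G P" and nonisolated: "\<And>v. v \<in> P \<Longrightarrow> open_nbhd G v \<noteq> {}"
  shows "one_limited_dominating_set G (verts G - P)"
proof -
  have same: "x = y" if "x \<in> P" "y \<in> P" "u \<in> closed_nbhd G x" "u \<in> closed_nbhd G y" for u x y
    using assms(1) that unfolding packing_def by blast
  have "open_nbhd G p \<inter> (verts G - P) \<noteq> {}" if p: "p \<in> P" for p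
  proof -
    obtain q where q: "q \<in> open_nbhd G p"
      using nonisolated[OF p] by blast
    have "q \<noteq> p"
      using q adj_not_same by (auto simp: open_nbhd_def)
    then have "q \<notin> P"
      using same[OF p, of q q] q by (auto simp: closed_nbhd_def)
    then show ?thesis
      using q by (auto simp: open_nbhd_def)
  qed
  moreover have "card (open_nbhd G u - (verts G - P)) \<le> 1" for u
  proof -
    have "x = y" if "x \<in> open_nbhd G u - (verts G - P)" "y \<in> open_nbhd G u - (verts G - P)" for x y
      using that same[of x y u] open_nbhd_sym
      by (auto simp: closed_nbhd_def open_nbhd_def)
    then show ?thesis
      using card_le_Suc0_iff_eq[of "open_nbhd G u - (verts G - P)"] finite_open_nbhd by auto
  qed
  ultimately show ?thesis
    by (auto simp: one_limited_dominating_set_def dominating_set_def)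
qed

lemma (in graph) one_limited_domination_number_le:
  assumes "one_limited_dominating_set G D"
  shows "one_limited_domination_number G \<le> card D"
  unfolding one_limited_domination_number_def
  using assms finite_one_limited_dominating_sets[OF graph_axioms] by (intro Min_le) auto

lemma (in graph) ex_min_one_limited_dominating_set:
  "\<exists>D. min_one_limited_dominating_set G D"
proof -
  have "Min (card ` {D. one_limited_dominating_set G D}) \<in> card ` {D. one_limited_dominating_set G D}"
    using finite_one_limited_dominating_sets[OF graph_axioms] one_limited_dominating_set_verts
    by (intro Min_in) auto
  then show ?thesis
    by (auto simp: min_one_limited_dominating_set_def one_limited_domination_number_def)
qed

lemma (in graph) ex_max_packing: "\<exists>P. max_packing G P"
proof -
  have "Max (card ` {S. packing G S}) \<in> card ` {S. packing G S}"
    using finite_packings[OF graph_axioms] packing_empty by (intro Max_in) auto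
  then show ?thesis
    by (auto simp: max_packing_def packing_number_def)
qed

theorem theorem13:
  fixes G :: "('a, 'b) pre_digraph"
  assumes "graph G"
    and "Digraph_Component.connected G"
    and "card (verts G) \<ge> 3"
  shows "\<lceil>real (card (verts G)) / 2\<rceil> \<le> int (one_limited_domination_number G)
    \<and> int (one_limited_domination_number G) \<le> int (card (verts G)) - int (packing_number G)
    \<and> (int (one_limited_domination_number G) = int (card (verts G)) - int (packing_number G)
        \<longleftrightarrow> (\<exists>P \<subseteq> verts G. max_packing G P \<and> min_one_limited_dominating_set G (verts G - P)))"
proof -
  interpret graph G by fact
  let ?n = "card (verts G)" and ?\<gamma> = "one_limited_domination_number G"
    and ?\<rho> = "packing_number G"
  have card_compl: "int (card (verts G - P)) = int ?n - int ?\<rho>" if "max_packing G P" for P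
  proof -
    have "P \<subseteq> verts G" "card P = ?\<rho>"
      using that by (auto simp: max_packing_def packing_def)
    then show ?thesis
      using card_Diff_subset[of P "verts G"] card_mono[of "verts G" P] finite_subset[of P "verts G"]
      by simp
  qed
  obtain P where P: "max_packing G P"
    using ex_max_packing by blast
  then have "P \<subseteq> verts G"
    by (simp add: max_packing_def packing_def)
  then have compl: "one_limited_dominating_set G (verts G - P)"
    using P open_nbhd_nonempty_if_connected[OF assms(2)] assms(3)
    by (intro one_limited_complement_of_packing) (auto simp: max_packing_def)
  have lower: "\<lceil>real ?n / 2\<rceil> \<le> int ?\<gamma>"
  proof -
    obtain D where "min_one_limited_dominating_set G D"
      using ex_min_one_limited_dominating_set by blast
    then have "?n \<le> 2 * ?\<gamma>"
      using card_verts_le_twice_one_limited[of D]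
      by (simp add: min_one_limited_dominating_set_def)
    then show ?thesis
      by (simp add: ceiling_le_iff)
  qed
  have upper: "int ?\<gamma> \<le> int ?n - int ?\<rho>"
    using one_limited_domination_number_le[OF compl] card_compl[OF P] by simp
  have "int ?\<gamma> = int ?n - int ?\<rho>
      \<longleftrightarrow> (\<exists>P \<subseteq> verts G. max_packing G P \<and> min_one_limited_dominating_set G (verts G - P))"
  proof
    assume "int ?\<gamma> = int ?n - int ?\<rho>"
    then have "min_one_limited_dominating_set G (verts G - P)"
      using compl card_compl[OF P] by (simp add: min_one_limited_dominating_set_def)
    with P \<open>P \<subseteq> verts G\<close>
    show "\<exists>P \<subseteq> verts G. max_packing G P \<and> min_one_limited_dominating_set G (verts G - P)"
      by blast
  next
    assume "\<exists>P \<subseteq> verts G. max_packing G P \<and> min_one_limited_dominating_set G (verts G - P)"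
    then show "int ?\<gamma> = int ?n - int ?\<rho>"
      unfolding min_one_limited_dominating_set_def using card_compl by metis
  qed
  with lower upper show ?thesis
    by blast
qed

end
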